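(* Let $E\subseteq\mathbb{C}$ be a connected compact set with connected complement and with $\gamma(E)>0$, such that $\gamma(E)=\gamma_c(E)$ but the Ahlfors function for $E$ is not equal on $\mathbb{C}_\infty\setminus E$ to the Cauchy transform of any complex Borel measure supported on $E$. Then there is no complex Borel measure $\mu$ supported on $E$ such that $$|\mathcal{C}_\mu(z)|\le 1 \qquad (z\in\mathbb{C}_\infty\setminus E)$$ and $\mu(E)=\gamma_c(E)$.
   Context: $\mathbb{C}_\infty$ is the Riemann sphere. Complex Borel measures are finite. Analytic capacity: for $E\subseteq\mathbb{C}$ compact, let $\Omega$ be the component of $\mathbb{C}_\infty\setminus E$ containing $\infty$, and let $H^\infty(\Omega)$ be the class of bounded holomorphic functions on $\Omega$. Then $\gamma(E):=\sup\{|f'(\infty)| : f\in H^\infty(\Omega),\ |f|\le 1\}$, where $f'(\infty):=\lim_{z\to\infty} z(f(z)-f(\infty))$. Ahlfors function: if $\gamma(E)>0$, the Ahlfors function for $E$ is the unique $f\in H^\infty(\Omega)$ with $|f|\le 1$ and $f'(\infty)=\gamma(E)$; by convention it is extended to be identically zero on each bounded component of $\mathbb{C}_\infty\setminus E$. Cauchy transform: for a complex Borel measure $\mu$ supported on $E$, $\mathcal{C}_\mu(z):=\int \frac{1}{\xi-z}\,d\mu(\xi)$ for $z\in\mathbb{C}_\infty\setminus E$ (with $\mathcal{C}_\mu(\infty)=0$). Cauchy capacity: $\gamma_c(E):=\sup\{|\mu(E)|\}$, the supremum being over all complex Borel measures $\mu$ supported on $E$ such that $|\mathcal{C}_\mu|\le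 1$ on $\mathbb{C}_\infty\setminus E$. *)

theory Defs
  imports "HOL-Analysis.Analysis"
begin

text \<open>The Riemann sphere is the one-point compactification of the plane: \<open>Some z\<close> is the finite
  point \<open>z\<close> and \<open>None\<close> is the point at infinity.\<close>

abbreviation riemann_sphere :: "complex option topology" where
  "riemann_sphere \<equiv> Alexandroff_compactification euclidean"

definition sphere_compl :: "complex set \<Rightarrow> complex option set" where
  "sphere_compl E = - (Some ` E)"

definition inv_chart :: "complex \<Rightarrow> complex option" where
  "inv_chart w = (if w = 0 then None else Some (1 / w))"

text \<open>Only meant for open sets \<open>U\<close>; the two charts \<open>Some\<close> and \<open>inv_chart\<close> cover the sphere.\<close>

definition sphere_holomorphic_on :: "(complex option \<Rightarrow> complex) \<Rightarrow> complex option set \<Rightarrow> bool" where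
  "sphere_holomorphic_on f U \<longleftrightarrow>
     (f \<circ> Some) holomorphic_on (Some -` U) \<and> (f \<circ> inv_chart) holomorphic_on (inv_chart -` U)"

definition H_infty :: "complex option set \<Rightarrow> (complex option \<Rightarrow> complex) set" where
  "H_infty U = {f. sphere_holomorphic_on f U \<and> bounded (f ` U)}"

definition deriv_infty :: "(complex option \<Rightarrow> complex) \<Rightarrow> complex" where
  "deriv_infty f = Lim at_infinity (\<lambda>z. z * (f (Some z) - f None))"

definition outer_component :: "complex set \<Rightarrow> complex option set" where
  "outer_component E =
     connected_component_of_set (subtopology riemann_sphere (sphere_compl E)) None"

definition analytic_capacity :: "complex set \<Rightarrow> real" where
  "analytic_capacity E = Sup {cmod (deriv_infty f) | f.
     f \<in> H_infty (outer_component E) \<and> (\<forall>z\<in>outer_component E. cmod (f z) \<le> 1)}"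

text \<open>The last conjunct is the convention that the Ahlfors function vanishes on the bounded
  components of the complement. HOL functions being total, it also gives the function the value 0
  at the points of \<open>E\<close>, which has no meaning but makes the description unique.\<close>

definition ahlfors_function :: "complex set \<Rightarrow> complex option \<Rightarrow> complex" where
  "ahlfors_function E = (THE f.
     f \<in> H_infty (outer_component E) \<and>
     (\<forall>z\<in>outer_component E. cmod (f z) \<le> 1) \<and>
     deriv_infty f = complex_of_real (analytic_capacity E) \<and>
     (\<forall>z. z \<notin> outer_component E \<longrightarrow> f z = 0))"

text \<open>A complex Borel measure is a countably additive complex-valued function of Borel sets; its
  values on other sets are irrelevant. Being complex-valued, it is automatically finite (of finite
  total variation).\<close>

definition complex_borel_measure :: "(complex set \<Rightarrow> complex) \<Rightarrow> bool" where
  "complex_borel_measure \<mu> \<longleftrightarrow>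
     (\<forall>A :: nat \<Rightarrow> complex set. range A \<subseteq> sets borel \<longrightarrow> disjoint_family A \<longrightarrow>
        (\<lambda>n. \<mu> (A n)) sums \<mu> (\<Union>n. A n))"

definition supported_on :: "(complex set \<Rightarrow> complex) \<Rightarrow> complex set \<Rightarrow> bool" where
  "supported_on \<mu> E \<longleftrightarrow> (\<forall>A\<in>sets borel. A \<inter> E = {} \<longrightarrow> \<mu> A = 0)"

text \<open>The positive variation of a real (signed) Borel measure \<open>\<nu>\<close>; the Jordan decomposition of \<open>\<nu>\<close>
  is \<open>positive_variation \<nu> - positive_variation (- \<nu>)\<close>. Note that \<open>ennreal\<close> sends negative reals
  to 0, which does not affect the supremum since \<open>\<nu> {} = 0\<close>.\<close>

definition positive_variation :: "(complex set \<Rightarrow> real) \<Rightarrow> complex measure" where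
  "positive_variation \<nu> =
     measure_of UNIV (sets borel) (\<lambda>A. SUP B\<in>{B \<in> sets borel. B \<subseteq> A}. ennreal (\<nu> B))"

definition signed_integral :: "(complex set \<Rightarrow> real) \<Rightarrow> (complex \<Rightarrow> complex) \<Rightarrow> complex" where
  "signed_integral \<nu> f =
     integral\<^sup>L (positive_variation \<nu>) f - integral\<^sup>L (positive_variation (\<lambda>A. - \<nu> A)) f"

definition complex_measure_integral ::
    "(complex set \<Rightarrow> complex) \<Rightarrow> (complex \<Rightarrow> complex) \<Rightarrow> complex" where
  "complex_measure_integral \<mu> f =
     signed_integral (\<lambda>A. Re (\<mu> A)) f + \<i> * signed_integral (\<lambda>A. Im (\<mu> A)) f"

definition cauchy_transform :: "(complex set \<Rightarrow> complex) \<Rightarrow> complex option \<Rightarrow> complex" where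
  "cauchy_transform \<mu> p =
     (case p of None \<Rightarrow> 0 | Some z \<Rightarrow> complex_measure_integral \<mu> (\<lambda>\<xi>. 1 / (\<xi> - z)))"

definition cauchy_capacity :: "complex set \<Rightarrow> real" where
  "cauchy_capacity E = Sup {cmod (\<mu> E) | \<mu>.
     complex_borel_measure \<mu> \<and> supported_on \<mu> E \<and>
     (\<forall>z\<in>sphere_compl E. cmod (cauchy_transform \<mu> z) \<le> 1)}"

end

theory Submission
  imports Defs "HOL-Complex_Analysis.Complex_Analysis"
begin

text \<open>If \<open>\<mu>\<close> attains the Cauchy capacity, then \<open>- C\<^sub>\<mu>\<close> is bounded by 1 and its derivative at infinity is
  \<open>\<mu> E = \<gamma>(E)\<close>, so by uniqueness of the extremal function it is the Ahlfors function, which is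
  therefore the Cauchy transform of \<open>- \<mu>\<close>. Uniqueness is proved with Fisher's argument: if two
  extremal functions differ by \<open>k \<noteq> 0\<close>, their midpoint plus a small multiple of a function comparable
  to \<open>k\<^sup>2\<close> near \<open>E\<close> has a larger derivative at infinity and is still bounded by 1.\<close>

section \<open>Positive variation of signed measures\<close>

text \<open>The square \<open>k\<^sup>2\<close> cannot itself be the perturbation: its derivative at
  infinity is 2 k(\<infinity>) k'(\<infinity>), and k'(\<infinity>) = 0 because both extremal
  functions have the same derivative there. An extra factor must produce a simple zero at infinity
  while staying bounded near \<open>E\<close>. If k has a zero of order n at infinity, the factor
  \<open>z ^ (2 * n - 1)\<close> does this; its growth is harmless because \<open>E\<close> is
  bounded and the maximum principle controls the rest. Extremal functions are not assumed to vanish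
  at infinity, so k(\<infinity>) may also be nonzero; then \<open>f - f None\<close> is the factor,
  and its derivative is the capacity. On the measure side, integrals are built from suprema over
  Borel subsets, which must be shown to be finite measures before a Cauchy transform can be
  differentiated.\<close>

locale signed_borel_measure =
  fixes \<nu> :: "complex set \<Rightarrow> real"
  assumes sums_UN: "range A \<subseteq> sets borel \<Longrightarrow> disjoint_family A \<Longrightarrow> (\<lambda>n. \<nu> (A n)) sums \<nu> (\<Union>n. A n)"
begin

lemma empty_eq_0 [simp]: "\<nu> {} = 0"
proof -
  \<comment> \<open>Additivity for a sequence of empty sets: a constant series converges only if its
    term is 0.\<close>
  have "(\<lambda>n::nat. \<nu> {}) sums \<nu> (\<Union>n::nat. {})"
    by (rule sums_UN) (auto simp: disjoint_family_on_def)
  then show ?thesis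
    using sums_summable summable_const_iff by blast
qed

lemma additive:
  assumes "A \<in> sets borel" "B \<in> sets borel" "A \<inter> B = {}"
  shows "\<nu> (A \<union> B) = \<nu> A + \<nu> B"
proof -
  have "(\<lambda>n. \<nu> (binaryset A B n)) sums \<nu> (\<Union>n. binaryset A B n)"
    using assms
    by (intro sums_UN) (auto simp: range_binaryset_eq disjoint_family_on_def binaryset_def)
  moreover have "(\<lambda>n. \<nu> (binaryset A B n)) sums (\<nu> A + \<nu> B)"
    by (rule binaryset_sums) simp
  ultimately show ?thesis
    using sums_unique2 by (fastforce simp: UN_binaryset_eq)
qed

lemma subtractive:
  assumes "A \<in> sets borel" "B \<in> sets borel" "B \<subseteq> A"
  shows "\<nu> (A - B) = \<nu> A - \<nu> B"
  using additive[of B "A - B"] assms by (simp add: Un_absorb1)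

text \<open>If \<open>\<nu>\<close> were unbounded, one could repeatedly split a set on which it is unbounded into two
  pieces of large measure, one of them again unbounded; the pieces discarded are disjoint and their
  measures do not tend to 0.\<close>

lemma bounded_values: "\<exists>M. \<forall>B\<in>sets borel. \<bar>\<nu> B\<bar> \<le> M"
proof (rule ccontr)
  define unb where "unb A \<longleftrightarrow> (\<forall>M. \<exists>B\<in>sets borel. B \<subseteq> A \<and> \<bar>\<nu> B\<bar> > M)" for A
  assume "\<not> (\<exists>M. \<forall>B\<in>sets borel. \<bar>\<nu> B\<bar> \<le> M)"
  then have unb_UNIV: "unb UNIV"
    by (auto simp: unb_def not_le)
  have unb_split: "unb B \<or> unb (A - B)"
    if "unb A" "A \<in> sets borel" "B \<in> sets borel" for A B
  proof (rule ccontr)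
    assume "\<not> (unb B \<or> unb (A - B))"
    then obtain M1 M2 where M1: "\<And>X. X \<in> sets borel \<Longrightarrow> X \<subseteq> B \<Longrightarrow> \<bar>\<nu> X\<bar> \<le> M1"
      and M2: "\<And>X. X \<in> sets borel \<Longrightarrow> X \<subseteq> A - B \<Longrightarrow> \<bar>\<nu> X\<bar> \<le> M2"
      unfolding unb_def by (metis not_le)
    obtain X where X: "X \<in> sets borel" "X \<subseteq> A" "\<bar>\<nu> X\<bar> > M1 + M2"
      using \<open>unb A\<close> unfolding unb_def by blast
    have "\<nu> X = \<nu> (X \<inter> B) + \<nu> (X - B)"
      using additive[of "X \<inter> B" "X - B"] X that by (simp add: Int_Diff_Un Int_Diff_disjoint)
    moreover have "\<bar>\<nu> (X \<inter> B)\<bar> \<le> M1" "\<bar>\<nu> (X - B)\<bar> \<le> M2"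
      using X that by (auto intro!: M1 M2)
    ultimately show False using X(3) by linarith
  qed
  have step: "\<exists>A'. (A' \<in> sets borel \<and> unb A') \<and> A' \<subseteq> A \<and> \<bar>\<nu> (A - A')\<bar> \<ge> 1"
    if "A \<in> sets borel \<and> unb A" for A
  proof -
    \<comment> \<open>The margin \<open>\<bar>\<nu> A\<bar> + 1\<close> makes both \<open>B\<close>
      and \<open>A - B\<close> have measure at least 1 in absolute value, so the discarded piece is
      large whichever of the two is kept.\<close>
    obtain B where B: "B \<in> sets borel" "B \<subseteq> A" "\<bar>\<nu> B\<bar> > \<bar>\<nu> A\<bar> + 1"
      using \<open>A \<in> sets borel \<and> unb A\<close> unfolding unb_def by blast
    have "\<bar>\<nu> (A - B)\<bar> \<ge> 1" "\<bar>\<nu> (A - (A - B))\<bar> \<ge> 1"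
      using B subtractive[of A B] that by (auto simp: double_diff)
    with unb_split[of A B] B that show ?thesis
      by (metis Diff_subset sets.Diff)
  qed
  obtain A where A: "\<And>n::nat. A n \<in> sets borel \<and> unb (A n)"
    and A': "\<And>n. A (Suc n) \<subseteq> A n \<and> \<bar>\<nu> (A n - A (Suc n))\<bar> \<ge> 1"
    using dependent_nat_choice[of "\<lambda>n A. A \<in> sets borel \<and> unb A"
        "\<lambda>n A A'. A' \<subseteq> A \<and> \<bar>\<nu> (A - A')\<bar> \<ge> 1"] unb_UNIV step by (metis borel_open open_UNIV)
  have dec: "A n \<subseteq> A m" if "m \<le> n" for m n
    using lift_Suc_antimono_le[of A m n] A' that by blast
  have "disjoint_family (\<lambda>n. A n - A (Suc n))"
    unfolding disjoint_family_on_def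
  proof (intro ballI impI)
    fix m n :: nat assume "m \<noteq> n"
    then consider "Suc m \<le> n" | "Suc n \<le> m" by linarith
    then show "(A m - A (Suc m)) \<inter> (A n - A (Suc n)) = {}"
      by cases (use dec in blast)+
  qed
  then have "(\<lambda>n. \<nu> (A n - A (Suc n))) sums \<nu> (\<Union>n. A n - A (Suc n))"
    using A by (intro sums_UN) auto
  then have "(\<lambda>n. \<nu> (A n - A (Suc n))) \<longlonglongrightarrow> 0"
    using summable_LIMSEQ_zero sums_summable by blast
  then obtain n where "\<bar>\<nu> (A n - A (Suc n))\<bar> < 1"
    by (fastforce dest: LIMSEQ_D[where r = 1])
  with A'[of n] show False by linarith
qed

text \<open>The real-valued form of the supremum in \<open>positive_variation\<close>. It is finite
  by \<open>bounded_values\<close>, so differences can be formed; \<open>SUP_ennreal\<close>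
  translates back.\<close>

definition pos :: "complex set \<Rightarrow> real" where
  "pos A = (SUP B\<in>{B \<in> sets borel. B \<subseteq> A}. \<nu> B)"

lemma pos_bdd: "bdd_above (\<nu> ` {B \<in> sets borel. B \<subseteq> A})"
proof -
  obtain M where "\<forall>B\<in>sets borel. \<bar>\<nu> B\<bar> \<le> M" using bounded_values by blast
  then show ?thesis by (intro bdd_aboveI2[of _ _ M]) (auto simp: abs_le_iff)
qed

lemma le_pos: "B \<in> sets borel \<Longrightarrow> B \<subseteq> A \<Longrightarrow> \<nu> B \<le> pos A"
  unfolding pos_def by (rule cSUP_upper) (auto intro: pos_bdd)

lemma pos_le: "(\<And>B. B \<in> sets borel \<Longrightarrow> B \<subseteq> A \<Longrightarrow> \<nu> B \<le> c) \<Longrightarrow> pos A \<le> c"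
  unfolding pos_def by (rule cSUP_least) auto

lemma pos_nonneg: "0 \<le> pos A"
  using le_pos[of "{}" A] by simp

lemma pos_empty [simp]: "pos {} = 0"
  by (rule antisym) (auto intro: pos_le pos_nonneg)

lemma pos_mono: "A \<subseteq> B \<Longrightarrow> pos A \<le> pos B"
  by (rule pos_le) (auto intro: le_pos)

text \<open>Borel subsets of \<open>A\<close> and of \<open>B\<close> can be chosen independently,
  and their union competes for \<open>A \<union> B\<close>; the two suprema are taken one at a
  time.\<close>

lemma pos_superadditive:
  assumes "A \<inter> B = {}"
  shows "pos A + pos B \<le> pos (A \<union> B)"
proof -
  have "pos A \<le> pos (A \<union> B) - pos B"
  proof (rule pos_le)
    fix X assume X: "X \<in> sets borel" "X \<subseteq> A"
    have "pos B \<le> pos (A \<union> B) - \<nu> X"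
    proof (rule pos_le)
      fix Y assume "Y \<in> sets borel" "Y \<subseteq> B"
      then have "\<nu> X + \<nu> Y \<le> pos (A \<union> B)"
        using X assms by (subst additive[symmetric]) (auto intro!: le_pos)
      then show "\<nu> Y \<le> pos (A \<union> B) - \<nu> X" by simp
    qed
    then show "\<nu> X \<le> pos (A \<union> B) - pos B" by simp
  qed
  then show ?thesis by simp
qed

text \<open>Superadditivity bounds the partial sums by the value at the union. Conversely, a
  competitor inside the union is cut along the pieces \<open>A n\<close>, and its measure is the sum
  over the cuts.\<close>

lemma pos_sums:
  assumes "range A \<subseteq> sets borel" "disjoint_family A"
  shows "(\<lambda>n. pos (A n)) sums pos (\<Union>n. A n)"
proof -
  have fin: "(\<Sum>i<n. pos (A i)) \<le> pos (\<Union>i<n. A i)" for n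
  proof (induction n)
    case (Suc n)
    have "A i \<inter> A n = {}" if "i < n" for i
      using assms(2) that by (simp add: disjoint_family_on_def)
    then have "(\<Union>i<n. A i) \<inter> A n = {}" by blast
    from pos_superadditive[OF this] Suc show ?case
      by (simp add: lessThan_Suc Un_commute)
  qed simp
  have fin': "(\<Sum>i<n. pos (A i)) \<le> pos (\<Union>i. A i)" for n
    by (rule order_trans[OF fin pos_mono]) blast
  have summ: "summable (\<lambda>n. pos (A n))"
    by (rule summableI_nonneg_bounded[OF pos_nonneg fin'])
  have "pos (\<Union>n. A n) \<le> (\<Sum>n. pos (A n))"
  proof (rule pos_le)
    fix B assume B: "B \<in> sets borel" "B \<subseteq> (\<Union>n. A n)"
    have "(\<lambda>n. \<nu> (B \<inter> A n)) sums \<nu> (\<Union>n. B \<inter> A n)"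
      using assms B by (intro sums_UN) (auto simp: disjoint_family_on_def)
    moreover have "(\<Union>n. B \<inter> A n) = B" using B by auto
    ultimately have "(\<lambda>n. \<nu> (B \<inter> A n)) sums \<nu> B" by simp
    moreover have "\<nu> (B \<inter> A n) \<le> pos (A n)" for n
      using B assms by (intro le_pos) auto
    ultimately show "\<nu> B \<le> (\<Sum>n. pos (A n))"
      using summ by (meson sums_le summable_sums)
  qed
  moreover have "(\<Sum>n. pos (A n)) \<le> pos (\<Union>n. A n)"
    using summ fin' by (simp add: suminf_le_const)
  ultimately show ?thesis
    using summ by (simp add: sums_iff)
qed

lemma SUP_ennreal: "(SUP B\<in>{B \<in> sets borel. B \<subseteq> A}. ennreal (\<nu> B)) = ennreal (pos A)"
proof (rule antisym)
  show "(SUP B\<in>{B \<in> sets borel. B \<subseteq> A}. ennreal (\<nu> B)) \<le> ennreal (pos A)"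
    by (rule SUP_least) (auto intro!: ennreal_leI le_pos)
  then obtain x where x: "(SUP B\<in>{B \<in> sets borel. B \<subseteq> A}. ennreal (\<nu> B)) = ennreal x" "0 \<le> x"
    using le_less_trans[OF _ ennreal_less_top] less_top_ennreal by blast
  have "pos A \<le> x"
  proof (rule pos_le)
    fix B assume "B \<in> sets borel" "B \<subseteq> A"
    then have "ennreal (\<nu> B) \<le> ennreal x"
      unfolding x(1)[symmetric] by (intro SUP_upper) auto
    then show "\<nu> B \<le> x" using x(2) by (simp add: ennreal_le_iff)
  qed
  then show "ennreal (pos A) \<le> (SUP B\<in>{B \<in> sets borel. B \<subseteq> A}. ennreal (\<nu> B))"
    unfolding x(1) by (rule ennreal_leI)
qed

lemma sets_positive_variation [simp, measurable_cong]: "sets (positive_variation \<nu>) = sets borel"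
  using sets.sets_measure_of_eq[of borel] by (simp add: positive_variation_def)

lemma space_positive_variation [simp]: "space (positive_variation \<nu>) = UNIV"
  by (simp add: positive_variation_def space_measure_of_conv)

text \<open>\<open>measure_of\<close> takes the prescribed values only if they are countably
  additive and is the zero measure otherwise; this is what \<open>pos_sums\<close> is for.\<close>

lemma emeasure_positive_variation:
  assumes "A \<in> sets borel"
  shows "emeasure (positive_variation \<nu>) A = ennreal (pos A)"
proof -
  have "positive (sets (positive_variation \<nu>)) (\<lambda>A. ennreal (pos A))"
    by (simp add: positive_def)
  moreover have "countably_additive (sets (positive_variation \<nu>)) (\<lambda>A. ennreal (pos A))"
    unfolding countably_additive_def
    by (auto intro!: suminf_ennreal_eq pos_nonneg pos_sums)
  moreover have "positive_variation \<nu> = measure_of UNIV (sets borel) (\<lambda>A. ennreal (pos A))"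
    unfolding positive_variation_def SUP_ennreal ..
  ultimately show ?thesis
    using assms emeasure_measure_of[of "positive_variation \<nu>" UNIV "sets borel" _ A] by simp
qed

lemma finite_measure_positive_variation: "finite_measure (positive_variation \<nu>)"
proof (rule finite_measureI)
  show "emeasure (positive_variation \<nu>) (space (positive_variation \<nu>)) \<noteq> \<infinity>"
    using emeasure_positive_variation[of UNIV] by simp
qed

lemma measure_positive_variation:
  "A \<in> sets borel \<Longrightarrow> measure (positive_variation \<nu>) A = pos A"
  by (simp add: measure_def emeasure_positive_variation pos_nonneg)

end

lemma signed_borel_measure_uminus:
  assumes "signed_borel_measure \<nu>"
  shows "signed_borel_measure (\<lambda>A. - \<nu> A)"
  using assms by (simp add: signed_borel_measure_def sums_minus)

text \<open>Since \<open>\<nu> B = \<nu> A - \<nu> (A - B)\<close>, passing from \<open>B\<close> to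
  \<open>A - B\<close> exchanges the competitors for the two variations, and each supremum bounds
  the other up to \<open>\<nu> A\<close>.\<close>

lemma Jordan_decomposition:
  assumes "signed_borel_measure \<nu>" "A \<in> sets borel"
  shows "measure (positive_variation \<nu>) A - measure (positive_variation (\<lambda>A. - \<nu> A)) A = \<nu> A"
proof -
  interpret p: signed_borel_measure \<nu> by fact
  interpret n: signed_borel_measure "\<lambda>A. - \<nu> A" by (rule signed_borel_measure_uminus) fact
  have "p.pos A \<le> \<nu> A + n.pos A"
  proof (rule p.pos_le)
    fix B assume "B \<in> sets borel" "B \<subseteq> A"
    then show "\<nu> B \<le> \<nu> A + n.pos A"
      using n.le_pos[of "A - B" A] p.subtractive[of A B] assms by auto
  qed
  moreover have "n.pos A \<le> p.pos A - \<nu> A"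
  proof (rule n.pos_le)
    fix B assume "B \<in> sets borel" "B \<subseteq> A"
    then show "- \<nu> B \<le> p.pos A - \<nu> A"
      using p.le_pos[of "A - B" A] p.subtractive[of A B] assms by auto
  qed
  ultimately show ?thesis
    using assms by (simp add: p.measure_positive_variation n.measure_positive_variation)
qed

lemma AE_positive_variation:
  assumes "signed_borel_measure \<nu>" "E \<in> sets borel"
    and "\<And>A. A \<in> sets borel \<Longrightarrow> A \<inter> E = {} \<Longrightarrow> \<nu> A = 0"
  shows "AE \<xi> in positive_variation \<nu>. \<xi> \<in> E"
proof -
  interpret signed_borel_measure \<nu> by fact
  have "pos (- E) \<le> 0"
    using assms(3) by (intro pos_le) (metis disjoint_eq_subset_Compl order_refl)
  then have "emeasure (positive_variation \<nu>) (- E) = 0"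
    using assms(2) by (simp add: emeasure_positive_variation ennreal_neg)
  then show ?thesis
    using assms(2) by (intro AE_I[where N = "- E"]) auto
qed

section \<open>Cauchy integrals of finite measures\<close>

text \<open>Dominated convergence along every sequence tending to \<open>a\<close>; the constant
  \<open>B\<close> is an integrable majorant because the measure is finite.\<close>

lemma tendsto_integral_within:
  fixes F :: "'b::metric_space \<Rightarrow> 'a \<Rightarrow> 'c::{banach, second_countable_topology}"
  assumes "finite_measure M" "\<And>z. F z \<in> borel_measurable M" "G \<in> borel_measurable M"
    and bound: "\<And>z. z \<in> S - {a} \<Longrightarrow> AE x in M. norm (F z x) \<le> B"
    and lim: "AE x in M. ((\<lambda>z. F z x) \<longlongrightarrow> G x) (at a within S)"
  shows "((\<lambda>z. integral\<^sup>L M (F z)) \<longlongrightarrow> integral\<^sup>L M G) (at a within S)"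
  unfolding tendsto_at_iff_sequentially o_def
proof (intro allI impI)
  fix X :: "nat \<Rightarrow> 'b" assume X: "\<forall>i. X i \<in> S - {a}" "X \<longlonglongrightarrow> a"
  interpret finite_measure M by fact
  show "(\<lambda>i. integral\<^sup>L M (F (X i))) \<longlonglongrightarrow> integral\<^sup>L M G"
  proof (rule integral_dominated_convergence[where w = "\<lambda>_. B"])
    show "AE x in M. (\<lambda>i. F (X i) x) \<longlonglongrightarrow> G x"
      using lim by eventually_elim (use X in \<open>auto simp: tendsto_at_iff_sequentially o_def\<close>)
  qed (use X assms in auto)
qed

locale finite_measure_on_compact = finite_measure M for M :: "complex measure" +
  fixes E :: "complex set"
  assumes sets_eq_borel [simp, measurable_cong]: "sets M = sets borel"
    and AE_in: "AE \<xi> in M. \<xi> \<in> E"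
    and compact: "compact E"
begin

lemma Cauchy_kernel_integrable:
  assumes "z \<notin> E"
  shows "integrable M (\<lambda>\<xi>. 1 / (\<xi> - z))"
proof -
  obtain d where d: "d > 0" "ball z d \<subseteq> - E"
    using open_contains_ball[of "- E"] compact assms by (auto dest: compact_imp_closed)
  show ?thesis
  proof (rule integrable_const_bound[where B = "1 / d"])
    show "AE \<xi> in M. cmod (1 / (\<xi> - z)) \<le> 1 / d"
      using AE_in
    proof eventually_elim
      case (elim \<xi>)
      then have "d \<le> cmod (\<xi> - z)"
        using d by (force simp: dist_norm norm_minus_commute)
      then show ?case using d by (simp add: norm_divide frac_le)
    qed
  qed measurable
qed

text \<open>The difference quotient of the kernel between \<open>a\<close> and \<open>z\<close> is
  \<open>1 / ((\<xi> - z) * (\<xi> - a))\<close>, which is bounded for \<open>\<xi>\<close> in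
  \<open>E\<close> and \<open>z\<close> near \<open>a\<close>, so the limit passes under the
  integral.\<close>

lemma Cauchy_integral_holomorphic: "(\<lambda>z. LINT \<xi>|M. 1 / (\<xi> - z)) holomorphic_on - E"
proof -
  let ?C = "\<lambda>z. LINT \<xi>|M. 1 / (\<xi> - z)"
  have "\<exists>D. (?C has_field_derivative D) (at a)" if "a \<notin> E" for a
  proof -
    obtain e where e: "e > 0" "ball a e \<subseteq> - E"
      using open_contains_ball[of "- E"] compact \<open>a \<notin> E\<close> by (auto dest: compact_imp_closed)
    \<comment> \<open>Halving the radius keeps all of \<open>ball a d\<close> at distance at least
      \<open>d\<close> from \<open>E\<close>.\<close>
    define d where "d = e / 2"
    have d: "d > 0" using e by (simp add: d_def)
    have sep: "d \<le> cmod (\<xi> - z)" if "\<xi> \<in> E" "z \<in> ball a d" for \<xi> z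
    proof -
      have "\<not> dist a \<xi> < e" using e that by auto
      moreover have "dist a z < d" using that by simp
      ultimately show ?thesis
        using dist_triangle[of a \<xi> z] by (simp add: d_def dist_norm norm_minus_commute)
    qed
    have nin: "z \<notin> E" if "z \<in> ball a d" for z
      using sep[of z z] that d by auto
    define F where "F z \<xi> = 1 / ((\<xi> - z) * (\<xi> - a))" for z \<xi>
    have "((\<lambda>z. integral\<^sup>L M (F z)) \<longlongrightarrow> integral\<^sup>L M (F a)) (at a within ball a d)"
    proof (rule tendsto_integral_within)
      show "finite_measure M" by (rule finite_measure_axioms)
      show "F z \<in> borel_measurable M" for z unfolding F_def by measurable
      then show "F a \<in> borel_measurable M" .
      show "AE \<xi> in M. cmod (F z \<xi>) \<le> 1 / (d * d)" if "z \<in> ball a d - {a}" for z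
        using AE_in
      proof eventually_elim
        case (elim \<xi>)
        then have "d * d \<le> cmod (\<xi> - z) * cmod (\<xi> - a)"
          using sep[of \<xi> z] sep[of \<xi> a] that d by (intro mult_mono) auto
        then show ?case using d by (simp add: F_def norm_divide norm_mult frac_le)
      qed
      show "AE \<xi> in M. ((\<lambda>z. F z \<xi>) \<longlongrightarrow> F a \<xi>) (at a within ball a d)"
        using AE_in
      proof eventually_elim
        case (elim \<xi>)
        then have "\<xi> \<noteq> a" using \<open>a \<notin> E\<close> by auto
        then show ?case unfolding F_def by (auto intro!: tendsto_eq_intros)
      qed
    qed
    moreover have "integral\<^sup>L M (F z) = (?C z - ?C a) / (z - a)" if "z \<noteq> a" "z \<in> ball a d" for z
    proof -
      have "(?C z - ?C a) / (z - a) = (LINT \<xi>|M. (1 / (\<xi> - z) - 1 / (\<xi> - a)) / (z - a))"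
        using Cauchy_kernel_integrable[of z] Cauchy_kernel_integrable[of a] nin that \<open>a \<notin> E\<close> by simp
      also have "\<dots> = integral\<^sup>L M (F z)"
      proof (rule integral_cong_AE)
        show "AE \<xi> in M. (1 / (\<xi> - z) - 1 / (\<xi> - a)) / (z - a) = F z \<xi>"
          using AE_in
        proof eventually_elim
          case (elim \<xi>)
          then have "\<xi> \<noteq> a" "\<xi> \<noteq> z" using \<open>a \<notin> E\<close> nin that by auto
          then show ?case using \<open>z \<noteq> a\<close> by (simp add: F_def divide_simps)
        qed
      qed (unfold F_def, measurable)
      finally show ?thesis by simp
    qed
    ultimately have "((\<lambda>z. (?C z - ?C a) / (z - a)) \<longlongrightarrow> integral\<^sup>L M (F a)) (at a within ball a d)"
      by (subst Lim_cong_within[OF refl refl refl, where g = "\<lambda>z. integral\<^sup>L M (F z)"]) auto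
    then show ?thesis
      using d at_within_open[of a "ball a d"] by (auto simp: has_field_derivative_iff)
  qed
  moreover have "open (- E)"
    using compact by (simp add: compact_imp_closed open_Compl)
  ultimately show ?thesis
    by (auto simp: holomorphic_on_open)
qed

text \<open>With \<open>w = 1 / z\<close> the integrand \<open>z / (\<xi> - z)\<close> becomes
  \<open>1 / (w * \<xi> - 1)\<close>, which tends to -1 as \<open>w\<close> tends to 0.\<close>

lemma Cauchy_integral_at_infinity:
  "((\<lambda>z. z * (LINT \<xi>|M. 1 / (\<xi> - z))) \<longlongrightarrow> - of_real (measure M UNIV)) at_infinity"
proof -
  obtain R where R: "R > 0" "\<And>\<xi>. \<xi> \<in> E \<Longrightarrow> cmod \<xi> \<le> R"
    using compact_imp_bounded[OF compact] bounded_pos by blast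
  \<comment> \<open>On this disc \<open>|w * \<xi>| \<le> 1 / 2\<close> for \<open>\<xi>\<close> in
    \<open>E\<close>, so the transformed kernel is bounded by 2.\<close>
  define d where "d = 1 / (2 * R)"
  have d: "d > 0" using R by (simp add: d_def)
  have sep: "1 / 2 \<le> cmod (w * \<xi> - 1)" if "\<xi> \<in> E" "w \<in> ball 0 d" for \<xi> w
  proof -
    have "cmod w * cmod \<xi> \<le> d * R"
      using R d that by (intro mult_mono) auto
    then have "cmod (w * \<xi>) \<le> 1 / 2"
      using R by (simp add: norm_mult d_def)
    then show ?thesis
      using norm_triangle_ineq2[of 1 "w * \<xi>"] by (simp add: norm_minus_commute)
  qed
  define F where "F w \<xi> = 1 / (w * \<xi> - 1)" for w \<xi> :: complex
  have lim: "((\<lambda>w. integral\<^sup>L M (F w)) \<longlongrightarrow> integral\<^sup>L M (F 0)) (at 0 within ball 0 d)"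
  proof (rule tendsto_integral_within)
    show "finite_measure M" by (rule finite_measure_axioms)
    show "F z \<in> borel_measurable M" for z unfolding F_def by measurable
    then show "F 0 \<in> borel_measurable M" .
    show "AE \<xi> in M. cmod (F w \<xi>) \<le> 2" if "w \<in> ball 0 d - {0}" for w
      using AE_in
    proof eventually_elim
      case (elim \<xi>)
      then have "1 / cmod (w * \<xi> - 1) \<le> 1 / (1 / 2)"
        using sep[of \<xi> w] that by (intro frac_le) auto
      then show ?case by (simp add: F_def norm_divide)
    qed
    show "AE \<xi> in M. ((\<lambda>w. F w \<xi>) \<longlongrightarrow> F 0 \<xi>) (at 0 within ball 0 d)"
      unfolding F_def by (auto intro!: tendsto_eq_intros)
  qed
  have F0: "integral\<^sup>L M (F 0) = - of_real (measure M UNIV)"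
  proof -
    have "F 0 = (\<lambda>_. - 1)" by (simp add: F_def fun_eq_iff)
    moreover have "space M = UNIV"
      using sets_eq_imp_space_eq[OF sets_eq_borel] by simp
    ultimately show ?thesis
      by (simp only: lebesgue_integral_const scaleR_conv_of_real mult_minus_right mult_1_right)
  qed
  have at0: "at 0 within ball 0 d = at (0::complex)"
    using d by (intro at_within_open) auto
  have eq: "integral\<^sup>L M (F w) = inverse w * (LINT \<xi>|M. 1 / (\<xi> - inverse w))" if "w \<noteq> 0" for w
  proof -
    have "w * (\<xi> - inverse w) = w * \<xi> - 1" for \<xi>
      using that by (simp add: right_diff_distrib)
    then have "F w \<xi> = inverse w * (1 / (\<xi> - inverse w))" for \<xi>
      unfolding F_def by (metis inverse_eq_divide inverse_mult_distrib)
    then have "F w = (\<lambda>\<xi>. inverse w * (1 / (\<xi> - inverse w)))" ..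
    then show ?thesis by (simp only: integral_mult_right_zero)
  qed
  show ?thesis
    unfolding lim_at_infinity_0 o_def
    by (rule Lim_cong_within[THEN iffD1, OF refl refl refl _ lim[unfolded F0 at0]]) (rule eq)
qed

end

section \<open>Holomorphic functions near infinity\<close>

lemma None_in_sphere_compl [simp]: "None \<in> sphere_compl E"
  and Some_in_sphere_compl [simp]: "Some z \<in> sphere_compl E \<longleftrightarrow> z \<notin> E"
  by (auto simp: sphere_compl_def)

lemma vimage_Some_sphere_compl [simp]: "Some -` sphere_compl E = - E"
  by auto

lemma inv_chart_0 [simp]: "inv_chart 0 = None"
  by (simp add: inv_chart_def)

lemma ball_subset_inv_chart_vimage:
  assumes "E \<subseteq> ball 0 R" "R > 0"
  shows "cball 0 (1 / R) \<subseteq> inv_chart -` sphere_compl E"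
proof
  fix w :: complex assume w: "w \<in> cball 0 (1 / R)"
  have "1 / w \<notin> E" if "w \<noteq> 0"
  proof
    assume "1 / w \<in> E"
    then have "1 / cmod w < R" using assms by (auto simp: norm_divide)
    then show False using w that \<open>R > 0\<close> by (simp add: field_simps)
  qed
  then show "w \<in> inv_chart -` sphere_compl E"
    by (auto simp: inv_chart_def)
qed

lemma compact_subset_ball:
  assumes "compact E"
  obtains R where "R > 0" "E \<subseteq> ball (0::complex) R"
proof -
  obtain R where "R > 0" "E \<subseteq> ball 0 R"
    using bounded_subset_ballD[OF compact_imp_bounded[OF assms], of 0] by blast
  then show ?thesis by (rule that)
qed

text \<open>Two open pieces cover the set: a disc around 0, which represents a neighbourhood of
  infinity free of \<open>E\<close>, and the nonzero points, where the chart is inversion.\<close>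

lemma open_inv_chart_vimage:
  assumes "compact E"
  shows "open (inv_chart -` sphere_compl E)"
proof -
  obtain R where R: "R > 0" "E \<subseteq> ball 0 R"
    using assms by (rule compact_subset_ball)
  have "open ((- {0}) \<inter> inverse -` (- E))"
    using assms by (intro continuous_open_preimage continuous_intros)
      (auto simp: compact_imp_closed open_Compl)
  moreover have "inv_chart -` sphere_compl E = ball 0 (1 / R) \<union> ((- {0}) \<inter> inverse -` (- E))"
  proof -
    have "ball 0 (1 / R) \<subseteq> inv_chart -` sphere_compl E"
      using ball_subset_inv_chart_vimage[OF R(2,1)] ball_subset_cball by blast
    then show ?thesis
      using R by (auto simp: inv_chart_def inverse_eq_divide split: if_splits)
  qed
  ultimately show ?thesis by auto
qed

text \<open>\<open>deriv_infty\<close> is a \<open>Lim\<close>, which says nothing unless the limit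
  exists. The convergence itself is therefore carried along, and \<open>deriv_infty_eq\<close>
  extracts the value.\<close>

abbreviation has_deriv_infty :: "(complex option \<Rightarrow> complex) \<Rightarrow> complex \<Rightarrow> bool" where
  "has_deriv_infty f L \<equiv> ((\<lambda>z. z * (f (Some z) - f None)) \<longlongrightarrow> L) at_infinity"

lemma deriv_infty_eq: "has_deriv_infty f L \<Longrightarrow> deriv_infty f = L"
  unfolding deriv_infty_def by (rule tendsto_Lim[OF trivial_limit_at_infinity])

text \<open>For \<open>w = 1 / z\<close> the expression under the limit is the difference quotient
  of \<open>f \<circ> inv_chart\<close> at 0.\<close>

lemma has_deriv_infty_iff:
  "has_deriv_infty f L \<longleftrightarrow> ((f \<circ> inv_chart) has_field_derivative L) (at 0)"
  unfolding lim_at_infinity_0 has_field_derivative_iff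
  by (rule Lim_cong_within) (auto simp: inv_chart_def field_simps)

lemma has_deriv_infty_imp_tendsto:
  assumes "has_deriv_infty f L"
  shows "((\<lambda>z. f (Some z)) \<longlongrightarrow> f None) at_infinity"
proof -
  have "isCont (f \<circ> inv_chart) 0"
    using assms by (auto simp: has_deriv_infty_iff intro: DERIV_isCont)
  then have "((f \<circ> inv_chart) \<longlongrightarrow> f None) (at 0)"
    by (simp add: isCont_def)
  then show ?thesis
    unfolding lim_at_infinity_0
    by (subst Lim_cong_within[OF refl refl refl, where g = "f \<circ> inv_chart"])
       (auto simp: inv_chart_def inverse_eq_divide)
qed

lemma sphere_holomorphic_onD:
  assumes "compact E" "sphere_holomorphic_on f (sphere_compl E)"
  shows "(\<lambda>z. f (Some z)) holomorphic_on - E"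
    and "(f \<circ> inv_chart) holomorphic_on inv_chart -` sphere_compl E"
    and "has_deriv_infty f (deriv_infty f)"
proof -
  show "(\<lambda>z. f (Some z)) holomorphic_on - E"
    and hol: "(f \<circ> inv_chart) holomorphic_on inv_chart -` sphere_compl E"
    using assms(2) by (auto simp: sphere_holomorphic_on_def o_def)
  have "((f \<circ> inv_chart) has_field_derivative deriv (f \<circ> inv_chart) 0) (at 0)"
    by (rule holomorphic_derivI[OF hol open_inv_chart_vimage[OF assms(1)]]) simp
  then have "has_deriv_infty f (deriv (f \<circ> inv_chart) 0)"
    by (simp add: has_deriv_infty_iff)
  with deriv_infty_eq[OF this] show "has_deriv_infty f (deriv_infty f)"
    by simp
qed

text \<open>A derivative at infinity makes \<open>f \<circ> inv_chart\<close> continuous at 0, so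
  the isolated singularity there is removable. Holomorphy on the sphere thus reduces to holomorphy
  in the plane and one limit.\<close>

lemma sphere_holomorphic_onI:
  assumes "compact E" "(\<lambda>z. f (Some z)) holomorphic_on - E" "has_deriv_infty f L"
  shows "sphere_holomorphic_on f (sphere_compl E)"
proof -
  let ?S = "inv_chart -` sphere_compl E"
  have "((\<lambda>z. f (Some z)) \<circ> inverse) holomorphic_on (?S - {0})"
    using assms(2)
    by (intro holomorphic_on_compose_gen[where t = "- E"] holomorphic_intros)
       (auto simp: inv_chart_def inverse_eq_divide)
  then have hol: "(f \<circ> inv_chart) holomorphic_on (?S - {0})"
    by (rule holomorphic_transform) (auto simp: inv_chart_def inverse_eq_divide)
  have "((f \<circ> inv_chart) has_field_derivative L) (at 0)"
    using assms(3) by (simp add: has_deriv_infty_iff)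
  then have "isCont (f \<circ> inv_chart) 0"
    by (rule DERIV_isCont)
  then have "(f \<circ> inv_chart) holomorphic_on ?S"
    by (intro no_isolated_singularity'[OF _ hol open_inv_chart_vimage[OF assms(1)]])
       (auto simp: isCont_def intro: tendsto_within_subset)
  then show ?thesis
    using assms(2) by (simp add: sphere_holomorphic_on_def o_def)
qed

text \<open>Inversion carries the exterior of the circle, with infinity, to a closed disc on which
  the function is holomorphic, and the circle to its boundary.\<close>

lemma maximum_modulus_outside_ball:
  assumes "compact E" "sphere_holomorphic_on f (sphere_compl E)"
    and R: "E \<subseteq> ball 0 R" "R > 0"
    and B: "\<And>z. cmod z = R \<Longrightarrow> cmod (f (Some z)) \<le> B"
  shows "cmod (f None) \<le> B" and "cmod z \<ge> R \<Longrightarrow> cmod (f (Some z)) \<le> B"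
proof -
  have hol: "(f \<circ> inv_chart) holomorphic_on cball 0 (1 / R)"
    using sphere_holomorphic_onD(2)[OF assms(1,2)] ball_subset_inv_chart_vimage[OF R]
    by (rule holomorphic_on_subset)
  have *: "cmod ((f \<circ> inv_chart) w) \<le> B" if "w \<in> cball 0 (1 / R)" for w
  proof (rule maximum_modulus_frontier[OF _ _ _ _ that])
    show "(f \<circ> inv_chart) holomorphic_on interior (cball 0 (1 / R))"
      using hol by (rule holomorphic_on_subset) (rule interior_subset)
    show "continuous_on (closure (cball 0 (1 / R))) (f \<circ> inv_chart)"
      using holomorphic_on_imp_continuous_on[OF hol] by simp
    fix w :: complex assume "w \<in> frontier (cball 0 (1 / R))"
    then have "cmod w = 1 / R" using R by simp
    moreover then have "w \<noteq> 0" using R by auto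
    ultimately show "cmod ((f \<circ> inv_chart) w) \<le> B"
      using B[of "1 / w"] by (simp add: inv_chart_def norm_divide)
  qed auto
  show "cmod (f None) \<le> B"
    using *[of 0] R by simp
  show "cmod (f (Some z)) \<le> B" if "cmod z \<ge> R"
  proof -
    have "z \<noteq> 0" using that R by auto
    then show ?thesis
      using *[of "1 / z"] that R by (simp add: inv_chart_def norm_divide frac_le)
  qed
qed

section \<open>Competitors for the analytic capacity and an a priori bound on them\<close>

definition sphere_unit_ball :: "complex set \<Rightarrow> (complex option \<Rightarrow> complex) set" where
  "sphere_unit_ball E = {f. sphere_holomorphic_on f (sphere_compl E) \<and>
     (\<forall>p\<in>sphere_compl E. cmod (f p) \<le> 1)}"

lemma sphere_unit_ball_iff:
  "f \<in> sphere_unit_ball E \<longleftrightarrow>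
     f \<in> H_infty (sphere_compl E) \<and> (\<forall>p\<in>sphere_compl E. cmod (f p) \<le> 1)"
  by (auto simp: sphere_unit_ball_def H_infty_def intro!: boundedI)

text \<open>Cauchy's inequality on the disc of radius \<open>1 / R\<close> in the chart at infinity.
  It makes the supremum in \<open>analytic_capacity\<close> one over a bounded set, so that
  competitors really lie below it.\<close>

lemma deriv_infty_le_radius:
  assumes "compact E" "f \<in> sphere_unit_ball E" and R: "E \<subseteq> ball 0 R" "R > 0"
  shows "cmod (deriv_infty f) \<le> R"
proof -
  have f: "sphere_holomorphic_on f (sphere_compl E)" "\<And>p. p \<in> sphere_compl E \<Longrightarrow> cmod (f p) \<le> 1"
    using assms(2) by (auto simp: sphere_unit_ball_def)
  have sub: "cball 0 (1 / R) \<subseteq> inv_chart -` sphere_compl E"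
    by (rule ball_subset_inv_chart_vimage[OF R])
  have hol: "(f \<circ> inv_chart) holomorphic_on cball 0 (1 / R)"
    using sphere_holomorphic_onD(2)[OF assms(1) f(1)] sub by (rule holomorphic_on_subset)
  have "cmod ((deriv ^^ 1) (f \<circ> inv_chart) 0) \<le> fact 1 * 1 / (1 / R) ^ 1"
  proof (rule Cauchy_inequality)
    show "(f \<circ> inv_chart) holomorphic_on ball 0 (1 / R)"
      using hol by (rule holomorphic_on_subset) (rule ball_subset_cball)
    show "continuous_on (cball 0 (1 / R)) (f \<circ> inv_chart)"
      using hol by (rule holomorphic_on_imp_continuous_on)
    show "cmod ((f \<circ> inv_chart) w) \<le> 1" if "cmod (0 - w) = 1 / R" for w
    proof -
      have "w \<in> cball 0 (1 / R)" using that by simp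
      with sub show ?thesis using f(2) by auto
    qed
  qed (use R in auto)
  moreover have "deriv (f \<circ> inv_chart) 0 = deriv_infty f"
    using sphere_holomorphic_onD(3)[OF assms(1) f(1)]
    by (intro DERIV_imp_deriv) (simp flip: has_deriv_infty_iff)
  ultimately show ?thesis by simp
qed

section \<open>Connectedness of the complement, on the sphere and in the plane\<close>

lemma outer_component_eq_sphere_compl:
  assumes "connectedin riemann_sphere (sphere_compl E)"
  shows "outer_component E = sphere_compl E"
proof
  show "outer_component E \<subseteq> sphere_compl E"
    unfolding outer_component_def
    using connected_component_of_subset_topspace[of "subtopology riemann_sphere (sphere_compl E)"]
    by force
  show "sphere_compl E \<subseteq> outer_component E"
    unfolding outer_component_def using assms
    by (intro connected_component_of_maximal) (auto simp: connectedin_subtopology)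
qed

text \<open>A bounded component \<open>C\<close> of \<open>- E\<close> would be open on the sphere,
  and so would the rest of the complement with infinity, because \<open>E \<union> C\<close> is
  compact; together they would disconnect the complement. The identity theorem is later applied on
  \<open>- E\<close>.\<close>

lemma connected_finite_part:
  assumes "compact E" "connectedin riemann_sphere (sphere_compl E)"
  shows "connected (- E)"
proof (rule ccontr)
  assume "\<not> connected (- E)"
  moreover have "bounded (- (- E))"
    using assms(1) by (simp add: compact_imp_bounded)
  ultimately obtain C where C: "C \<in> components (- E)" "bounded C"
    using cobounded_has_bounded_component[of "- E"] by auto
  have op: "open (- E)" using assms(1) by (simp add: compact_imp_closed open_Compl)
  then have "open C" using C(1) by (rule open_components)
  have "open (- E - C)"
    using openin_diff[OF openin_subtopology_self closedin_component[OF C(1)]] op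
    by (rule openin_open_trans)
  moreover have "- (- E - C) = E \<union> C" using in_components_subset[OF C(1)] by auto
  ultimately have "closed (E \<union> C)"
    by (metis closed_Compl)
  then have comp: "compact (E \<union> C)"
    using assms(1) C(2) by (auto simp: compact_eq_bounded_closed)
  have 1: "openin riemann_sphere (Some ` C)"
    using \<open>open C\<close> by (auto simp: openin_Alexandroff_compactification)
  have 2: "openin riemann_sphere (insert None (Some ` (- (E \<union> C))))"
    unfolding openin_Alexandroff_compactification
    using comp by (intro disjI2 exI[of _ "E \<union> C"]) (auto simp: compact_imp_closed Compl_eq_Diff_UNIV)
  have "C \<noteq> {}" "C \<subseteq> - E"
    using C(1) in_components_nonempty in_components_subset by blast+
  then show False
    by (intro connectedinD[OF assms(2) 1 2]) (auto simp: sphere_compl_def)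
qed

section \<open>Uniqueness of the extremal function\<close>

lemma deriv_infty_le_analytic_capacity:
  assumes "compact E" "connectedin riemann_sphere (sphere_compl E)" "f \<in> sphere_unit_ball E"
  shows "cmod (deriv_infty f) \<le> analytic_capacity E"
proof -
  obtain R where R: "R > 0" "E \<subseteq> ball 0 R"
    using assms(1) by (rule compact_subset_ball)
  have "analytic_capacity E = (SUP f\<in>sphere_unit_ball E. cmod (deriv_infty f))"
    unfolding analytic_capacity_def outer_component_eq_sphere_compl[OF assms(2)]
      setcompr_eq_image sphere_unit_ball_iff[symmetric] by simp
  moreover have "bdd_above ((\<lambda>f. cmod (deriv_infty f)) ` sphere_unit_ball E)"
    by (rule bdd_aboveI2) (rule deriv_infty_le_radius[OF assms(1) _ R(2,1)])
  ultimately show ?thesis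
    using assms(3) by (auto intro: cSUP_upper)
qed

text \<open>The parallelogram law gives \<open>|a + b|^2 + |a - b|^2 \<le> 4\<close>, and
  \<open>4 * t \<le> 4 + t^2\<close> for \<open>t = |a + b|\<close> removes the square; adding the
  two produces the 8.\<close>

lemma norm_midpoint_le:
  fixes a b :: complex
  assumes "cmod a \<le> 1" "cmod b \<le> 1"
  shows "cmod ((a + b) / 2) + (cmod (a - b))\<^sup>2 / 8 \<le> 1"
proof -
  have "(cmod a)\<^sup>2 \<le> 1" "(cmod b)\<^sup>2 \<le> 1"
    using assms by (auto simp: power_le_one)
  moreover have "(cmod (a + b))\<^sup>2 + (cmod (a - b))\<^sup>2 = 2 * (cmod a)\<^sup>2 + 2 * (cmod b)\<^sup>2"
    unfolding cmod_power2 by (simp add: power2_eq_square algebra_simps)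
  moreover have "4 * cmod (a + b) \<le> 4 + (cmod (a + b))\<^sup>2"
    using zero_le_power2[of "cmod (a + b) - 2"] by (simp add: power2_eq_square algebra_simps)
  ultimately show ?thesis
    by (simp add: norm_divide)
qed

text \<open>Two extremal functions \<open>f\<close>, \<open>g\<close> leave room for a perturbation of their midpoint: if
  \<open>|Q| \<le> M |f - g|\<^sup>2\<close> near \<open>E\<close>, then \<open>(f + g) / 2 + c Q\<close> is still bounded by 1 for small \<open>c\<close>, by
  the parallelogram law near \<open>E\<close> and by the maximum principle elsewhere.\<close>

lemma extremal_perturbation:
  assumes E: "compact E" "connectedin riemann_sphere (sphere_compl E)"
    and f: "f \<in> sphere_unit_ball E" "deriv_infty f = of_real (analytic_capacity E)"
    and g: "g \<in> sphere_unit_ball E" "deriv_infty g = of_real (analytic_capacity E)"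
    and Q: "sphere_holomorphic_on Q (sphere_compl E)"
    and R: "E \<subseteq> ball 0 R" "R > 0" and M: "M > 0"
    and QM: "\<And>z. z \<notin> E \<Longrightarrow> cmod z \<le> R \<Longrightarrow> cmod (Q (Some z)) \<le> M * (cmod (f (Some z) - g (Some z)))\<^sup>2"
  shows "deriv_infty Q = 0"
proof (rule ccontr)
  let ?\<gamma> = "analytic_capacity E" and ?q = "deriv_infty Q"
  assume "?q \<noteq> 0"
  \<comment> \<open>The conjugate rotates \<open>c * ?q\<close> onto the positive real axis, so that
    it adds to the capacity; the modulus \<open>1 / (8 * M)\<close> uses exactly the slack granted
    by \<open>norm_midpoint_le\<close>.\<close>
  define c where "c = of_real (1 / (8 * M)) * cnj ?q / of_real (cmod ?q)"
  define F where "F p = (f p + g p) / 2 + c * Q p" for p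
  have cmod_c: "cmod c = 1 / (8 * M)"
    using \<open>?q \<noteq> 0\<close> M by (simp add: c_def norm_mult norm_divide)
  have "cnj ?q * ?q = of_real ((cmod ?q)\<^sup>2)"
    by (simp only: complex_norm_square mult.commute)
  then have cq: "c * ?q = of_real (cmod ?q / (8 * M))"
    using \<open>?q \<noteq> 0\<close> by (simp add: c_def power2_eq_square)
  have f': "sphere_holomorphic_on f (sphere_compl E)" "\<And>p. p \<in> sphere_compl E \<Longrightarrow> cmod (f p) \<le> 1"
    and g': "sphere_holomorphic_on g (sphere_compl E)" "\<And>p. p \<in> sphere_compl E \<Longrightarrow> cmod (g p) \<le> 1"
    using f g by (auto simp: sphere_unit_ball_def)
  have "((\<lambda>z. (z * (f (Some z) - f None) + z * (g (Some z) - g None)) / 2 + c * (z * (Q (Some z) - Q None)))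
      \<longlongrightarrow> (of_real ?\<gamma> + of_real ?\<gamma>) / 2 + c * ?q) at_infinity"
    using sphere_holomorphic_onD(3)[OF E(1) f'(1)] sphere_holomorphic_onD(3)[OF E(1) g'(1)]
      sphere_holomorphic_onD(3)[OF E(1) Q] f(2) g(2)
    by (intro tendsto_intros) auto
  moreover have "(z * (f (Some z) - f None) + z * (g (Some z) - g None)) / 2
      + c * (z * (Q (Some z) - Q None)) = z * (F (Some z) - F None)" for z
    by (simp add: F_def field_simps)
  moreover have "(of_real ?\<gamma> + of_real ?\<gamma>) / 2 + c * ?q = of_real (?\<gamma> + cmod ?q / (8 * M))"
    by (simp add: cq)
  ultimately have F_deriv: "has_deriv_infty F (of_real (?\<gamma> + cmod ?q / (8 * M)))"
    by (simp only:)
  have F_hol: "sphere_holomorphic_on F (sphere_compl E)"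
  proof (rule sphere_holomorphic_onI[OF E(1) _ F_deriv])
    show "(\<lambda>z. F (Some z)) holomorphic_on - E"
      unfolding F_def using sphere_holomorphic_onD(1)[OF E(1)] f'(1) g'(1) Q
      by (intro holomorphic_intros) auto
  qed
  have near: "cmod (F (Some z)) \<le> 1" if "z \<notin> E" "cmod z \<le> R" for z
  proof -
    have "cmod c * cmod (Q (Some z)) \<le> cmod c * (M * (cmod (f (Some z) - g (Some z)))\<^sup>2)"
      using QM that by (intro mult_left_mono) auto
    also have "\<dots> = (cmod (f (Some z) - g (Some z)))\<^sup>2 / 8"
      using M by (simp add: cmod_c)
    finally have "cmod (c * Q (Some z)) \<le> (cmod (f (Some z) - g (Some z)))\<^sup>2 / 8"
      by (simp add: norm_mult)
    moreover have "cmod ((f (Some z) + g (Some z)) / 2) + (cmod (f (Some z) - g (Some z)))\<^sup>2 / 8 \<le> 1"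
      using f'(2) g'(2) that by (intro norm_midpoint_le) auto
    moreover have "cmod (F (Some z)) \<le> cmod ((f (Some z) + g (Some z)) / 2) + cmod (c * Q (Some z))"
      unfolding F_def by (rule norm_triangle_ineq)
    ultimately show ?thesis by linarith
  qed
  \<comment> \<open>\<open>E\<close> lies in the open ball, so the whole circle belongs to the
    complement and to the region covered by \<open>near\<close>.\<close>
  have on_circle: "cmod (F (Some z)) \<le> 1" if "cmod z = R" for z
    using R that by (intro near) auto
  note far = maximum_modulus_outside_ball[OF E(1) F_hol R on_circle]
  have "cmod (F p) \<le> 1" if "p \<in> sphere_compl E" for p
  proof (cases p)
    case None
    then show ?thesis using far(1) by simp
  next
    case (Some z)
    then show ?thesis
      using near[of z] far(2)[of z] that by (cases "cmod z \<le> R") auto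
  qed
  then have "F \<in> sphere_unit_ball E"
    using F_hol by (simp add: sphere_unit_ball_def)
  then have "cmod (deriv_infty F) \<le> ?\<gamma>"
    by (rule deriv_infty_le_analytic_capacity[OF E])
  then have "?\<gamma> + cmod ?q / (8 * M) \<le> ?\<gamma>"
    unfolding deriv_infty_eq[OF F_deriv] norm_of_real by linarith
  moreover have "cmod ?q / (8 * M) > 0"
    using \<open>?q \<noteq> 0\<close> M by simp
  ultimately show False by linarith
qed

text \<open>If the values differ, \<open>(f - g)\<^sup>2\<close> does not vanish at infinity, and
  times \<open>f - f None\<close> it has derivative \<open>(f None - g None)\<^sup>2\<close> times
  the capacity there. Positivity of the capacity makes this nonzero.\<close>

lemma extremal_eq_at_infinity:
  assumes E: "compact E" "connectedin riemann_sphere (sphere_compl E)" "analytic_capacity E > 0"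
    and f: "f \<in> sphere_unit_ball E" "deriv_infty f = of_real (analytic_capacity E)"
    and g: "g \<in> sphere_unit_ball E" "deriv_infty g = of_real (analytic_capacity E)"
  shows "f None = g None"
proof (rule ccontr)
  assume neq: "f None \<noteq> g None"
  define Q where "Q p = (f p - g p)\<^sup>2 * (f p - f None)" for p
  obtain R where R: "R > 0" "E \<subseteq> ball 0 R"
    using E(1) by (rule compact_subset_ball)
  have f': "sphere_holomorphic_on f (sphere_compl E)" "\<And>p. p \<in> sphere_compl E \<Longrightarrow> cmod (f p) \<le> 1"
    and g': "sphere_holomorphic_on g (sphere_compl E)"
    using f g by (auto simp: sphere_unit_ball_def)
  note f_deriv = sphere_holomorphic_onD(3)[OF E(1) f'(1)]
    and g_deriv = sphere_holomorphic_onD(3)[OF E(1) g'(1)]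
  have "((\<lambda>z. (f (Some z) - g (Some z))\<^sup>2 * (z * (f (Some z) - f None))) \<longlongrightarrow>
      (f None - g None)\<^sup>2 * deriv_infty f) at_infinity"
    by (intro tendsto_intros has_deriv_infty_imp_tendsto[OF f_deriv]
        has_deriv_infty_imp_tendsto[OF g_deriv] f_deriv)
  then have Q_deriv: "has_deriv_infty Q ((f None - g None)\<^sup>2 * deriv_infty f)"
    by (simp add: Q_def mult_ac)
  have "sphere_holomorphic_on Q (sphere_compl E)"
  proof (rule sphere_holomorphic_onI[OF E(1) _ Q_deriv])
    show "(\<lambda>z. Q (Some z)) holomorphic_on - E"
      unfolding Q_def using sphere_holomorphic_onD(1)[OF E(1)] f'(1) g'(1)
      by (intro holomorphic_intros) auto
  qed
  then have "deriv_infty Q = 0"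
  proof (rule extremal_perturbation[OF E(1,2) f g _ R(2,1)])
    fix z assume "z \<notin> E"
    then have "cmod (f (Some z) - f None) \<le> 1 + 1"
      using f'(2) by (intro order_trans[OF norm_triangle_ineq4] add_mono) auto
    then have "cmod (f (Some z) - f None) * (cmod (f (Some z) - g (Some z)))\<^sup>2
        \<le> 2 * (cmod (f (Some z) - g (Some z)))\<^sup>2"
      by (intro mult_right_mono) auto
    then show "cmod (Q (Some z)) \<le> 2 * (cmod (f (Some z) - g (Some z)))\<^sup>2"
      by (simp add: Q_def norm_mult norm_power mult.commute)
  qed simp
  then show False
    using deriv_infty_eq[OF Q_deriv] f(2) neq E(3) by simp
qed

text \<open>In the chart at infinity \<open>f - g\<close> vanishes at 0. The perturbation excludes a
  zero of finite order, so the difference is 0 near infinity, and the identity theorem spreads this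
  over \<open>- E\<close>.\<close>

lemma extremal_unique:
  assumes E: "compact E" "connectedin riemann_sphere (sphere_compl E)" "analytic_capacity E > 0"
    and f: "f \<in> sphere_unit_ball E" "deriv_infty f = of_real (analytic_capacity E)"
    and g: "g \<in> sphere_unit_ball E" "deriv_infty g = of_real (analytic_capacity E)"
    and p: "p \<in> sphere_compl E"
  shows "f p = g p"
proof -
  obtain R where R: "R > 0" "E \<subseteq> ball 0 R"
    using E(1) by (rule compact_subset_ball)
  have f': "sphere_holomorphic_on f (sphere_compl E)"
    and g': "sphere_holomorphic_on g (sphere_compl E)"
    using f g by (auto simp: sphere_unit_ball_def)
  have eq_infty: "f None = g None"
    using E f g by (rule extremal_eq_at_infinity)
  define K where "K w = f (inv_chart w) - g (inv_chart w)" for w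
  have "K holomorphic_on inv_chart -` sphere_compl E"
    unfolding K_def using sphere_holomorphic_onD(2)[OF E(1)] f' g'
    by (intro holomorphic_intros) (auto simp: o_def)
  moreover have "ball 0 (1 / R) \<subseteq> inv_chart -` sphere_compl E"
    using ball_subset_inv_chart_vimage[OF R(2,1)] ball_subset_cball by blast
  ultimately have K_hol: "K holomorphic_on ball 0 (1 / R)"
    by (rule holomorphic_on_subset)
  have K_0: "K 0 = 0" by (simp add: K_def eq_infty)
  have K_const: "K constant_on ball 0 (1 / R)"
  proof (rule ccontr)
    assume nonconst: "\<not> K constant_on ball 0 (1 / R)"
    have "0 \<in> ball (0::complex) (1 / R)" using R(1) by simp
    then obtain k r n where n: "n > 0" and r: "r > 0" "ball (0::complex) r \<subseteq> ball 0 (1 / R)"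
      and k: "k holomorphic_on ball 0 r" "\<And>w. w \<in> ball 0 r \<Longrightarrow> K w = (w - 0) ^ n * k w"
        "\<And>w. w \<in> ball 0 r \<Longrightarrow> k w \<noteq> 0"
      by (rule holomorphic_factor_zero_nonconstant[OF K_hol open_ball connected_ball _ K_0 nonconst])
         (rule that)
    \<comment> \<open>Since \<open>f - g\<close> is \<open>w ^ n * k w\<close> with
      \<open>w = 1 / z\<close>, the power of \<open>z\<close> cancels all but one of the
      \<open>2 * n\<close> zeros, leaving the derivative \<open>(k 0)\<^sup>2\<close> at infinity.
      The value 0 at \<open>None\<close> is the limit of the finite branch.\<close>
    define Q where "Q p = (case p of None \<Rightarrow> 0 | Some z \<Rightarrow> z ^ (2 * n - 1) * (f p - g p)\<^sup>2)" for p
    have "isCont k 0"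
      using continuous_on_interior[OF holomorphic_on_imp_continuous_on[OF k(1)]] r(1) by simp
    then have "((\<lambda>w. (k w)\<^sup>2) \<longlongrightarrow> (k 0)\<^sup>2) (at 0)"
      by (intro tendsto_intros) (simp add: isCont_def)
    then have lim: "((\<lambda>w. (k w)\<^sup>2) \<longlongrightarrow> (k 0)\<^sup>2) (at 0 within ball 0 r)"
      by (rule tendsto_within_subset) simp
    have eq: "(k w)\<^sup>2 = inverse w * (Q (Some (inverse w)) - Q None)" if "w \<noteq> 0" "w \<in> ball 0 r" for w
    proof -
      have "f (Some (inverse w)) - g (Some (inverse w)) = w ^ n * k w"
        using k(2)[OF that(2)] that(1) by (simp add: K_def inv_chart_def inverse_eq_divide)
      then have "inverse w * (Q (Some (inverse w)) - Q None)
          = (inverse w * inverse w ^ (2 * n - 1)) * (w ^ n * w ^ n) * (k w)\<^sup>2"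
        by (simp add: Q_def power2_eq_square mult_ac)
      \<comment> \<open>Here \<open>n > 0\<close> matters: with truncated subtraction,
        \<open>2 * n - 1 + 1 = 2 * n\<close> would fail for \<open>n = 0\<close>.\<close>
      also have "inverse w * inverse w ^ (2 * n - 1) = inverse w ^ n * inverse w ^ n"
        using n by (simp flip: power_Suc power_add add: mult_2)
      also have "inverse w ^ n * inverse w ^ n * (w ^ n * w ^ n) = 1"
        using that(1) by (simp add: power_inverse field_simps)
      finally show ?thesis by simp
    qed
    have "((\<lambda>w. inverse w * (Q (Some (inverse w)) - Q None)) \<longlongrightarrow> (k 0)\<^sup>2) (at 0 within ball 0 r)"
      by (rule Lim_cong_within[THEN iffD1, OF refl refl refl _ lim]) (rule eq)
    moreover have "at 0 within ball (0::complex) r = at 0"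
      using r(1) by (intro at_within_open) auto
    ultimately have Q_deriv: "has_deriv_infty Q ((k 0)\<^sup>2)"
      unfolding lim_at_infinity_0 o_def by (simp only:)
    have "sphere_holomorphic_on Q (sphere_compl E)"
    proof (rule sphere_holomorphic_onI[OF E(1) _ Q_deriv])
      show "(\<lambda>z. Q (Some z)) holomorphic_on - E"
        unfolding Q_def option.case using sphere_holomorphic_onD(1)[OF E(1)] f' g'
        by (intro holomorphic_intros) auto
    qed
    then have "deriv_infty Q = 0"
    proof (rule extremal_perturbation[OF E(1,2) f g _ R(2,1)])
      fix z assume "cmod z \<le> R"
      then show "cmod (Q (Some z)) \<le> R ^ (2 * n - 1) * (cmod (f (Some z) - g (Some z)))\<^sup>2"
        by (auto simp: Q_def norm_mult norm_power intro!: mult_right_mono power_mono)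
    qed (use R in simp)
    then show False
      using deriv_infty_eq[OF Q_deriv] k(3)[of 0] r(1) by simp
  qed
  have K_zero: "K w = 0" if "w \<in> ball 0 (1 / R)" for w
  proof -
    obtain c where "\<forall>w\<in>ball 0 (1 / R). K w = c"
      using K_const unfolding constant_on_def by blast
    moreover have "0 \<in> ball (0::complex) (1 / R)" using R(1) by simp
    ultimately show ?thesis using K_0 that by metis
  qed
  have outside: "f (Some z) - g (Some z) = 0" if "z \<in> - cball 0 R" for z
  proof -
    have "z \<noteq> 0" "1 / z \<in> ball 0 (1 / R)"
      using that R(1) by (auto simp: norm_divide frac_less2)
    then show ?thesis
      using K_zero[of "1 / z"] by (simp add: K_def inv_chart_def)
  qed
  show ?thesis
  proof (cases p)
    case None
    then show ?thesis by (simp add: eq_infty)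
  next
    case (Some z)
    have "f (Some z) - g (Some z) = 0"
    proof (rule analytic_continuation[where f = "\<lambda>z. f (Some z) - g (Some z)" and w = z
          and S = "- E" and U = "- cball 0 R" and \<xi> = "of_real (R + 1)"])
      show "(\<lambda>z. f (Some z) - g (Some z)) holomorphic_on - E"
        using sphere_holomorphic_onD(1)[OF E(1)] f' g' by (intro holomorphic_intros) auto
      show "open (- E)" using E(1) by (simp add: compact_imp_closed open_Compl)
      show "connected (- E)" using E(1,2) by (rule connected_finite_part)
      show "- cball 0 R \<subseteq> - E" using R(2) ball_subset_cball by blast
      \<comment> \<open>Any point of the open exterior serves as the accumulation point of
        zeros.\<close>
      have mem: "of_real (R + 1) \<in> - cball (0::complex) R" using R(1) by (simp del: of_real_add)
      show "of_real (R + 1) islimpt - cball (0::complex) R"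
        using mem by (intro interior_limit_point) (simp add: interior_open open_Compl)
      show "of_real (R + 1) \<in> - E"
        using mem \<open>- cball 0 R \<subseteq> - E\<close> by blast
      show "z \<in> - E" using p Some by simp
    qed (rule outside)
    then show ?thesis using Some by simp
  qed
qed

text \<open>A definite description has no usable property before uniqueness is known. As
  \<open>extremal_unique\<close> compares functions only on the complement, \<open>f\<close> is
  replaced by \<open>f0\<close>, which also obeys the convention on the remaining points.\<close>

lemma ahlfors_function_eq:
  assumes E: "compact E" "connectedin riemann_sphere (sphere_compl E)" "analytic_capacity E > 0"
    and f: "f \<in> sphere_unit_ball E" "deriv_infty f = of_real (analytic_capacity E)"
    and p: "p \<in> sphere_compl E"
  shows "ahlfors_function E p = f p"
proof -
  note outer = outer_component_eq_sphere_compl[OF E(2)]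
  define f0 where "f0 p = (if p \<in> sphere_compl E then f p else 0)" for p
  have f_hol: "sphere_holomorphic_on f (sphere_compl E)"
    using f(1) by (simp add: sphere_unit_ball_def)
  have deriv_f0: "has_deriv_infty f0 (deriv_infty f)"
  proof -
    obtain R where R: "R > 0" "E \<subseteq> ball 0 R"
      using E(1) by (rule compact_subset_ball)
    \<comment> \<open>The modification takes place on \<open>E\<close>, inside the ball, and so does
      not affect the limit at infinity.\<close>
    have "f (Some z) = f0 (Some z)" if "R \<le> cmod z" for z
      using that R by (auto simp: f0_def)
    then have "eventually (\<lambda>z. z * (f (Some z) - f None) = z * (f0 (Some z) - f0 None)) at_infinity"
      unfolding eventually_at_infinity by (intro exI[of _ R]) (simp add: f0_def)
    then show ?thesis
      using sphere_holomorphic_onD(3)[OF E(1) f_hol] by (rule Lim_transform_eventually[rotated])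
  qed
  have "(\<lambda>z. f0 (Some z)) holomorphic_on - E"
    using sphere_holomorphic_onD(1)[OF E(1) f_hol]
    by (rule holomorphic_transform) (simp add: f0_def)
  then have "sphere_holomorphic_on f0 (sphere_compl E)"
    using deriv_f0 by (rule sphere_holomorphic_onI[OF E(1)])
  then have f0: "f0 \<in> sphere_unit_ball E"
    using f(1) by (auto simp: sphere_unit_ball_def f0_def)
  have f0': "deriv_infty f0 = of_real (analytic_capacity E)"
    using deriv_infty_eq[OF deriv_f0] f(2) by simp
  have "ahlfors_function E = f0"
    unfolding ahlfors_function_def outer
  proof (rule the_equality)
    show "f0 \<in> H_infty (sphere_compl E) \<and> (\<forall>z\<in>sphere_compl E. cmod (f0 z) \<le> 1) \<and>
        deriv_infty f0 = of_real (analytic_capacity E) \<and> (\<forall>z. z \<notin> sphere_compl E \<longrightarrow> f0 z = 0)"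
      using f0 f0' by (simp add: sphere_unit_ball_iff) (simp add: f0_def)
    fix g assume "g \<in> H_infty (sphere_compl E) \<and> (\<forall>z\<in>sphere_compl E. cmod (g z) \<le> 1) \<and>
        deriv_infty g = of_real (analytic_capacity E) \<and> (\<forall>z. z \<notin> sphere_compl E \<longrightarrow> g z = 0)"
    then have g: "g \<in> sphere_unit_ball E" "deriv_infty g = of_real (analytic_capacity E)"
      and g0: "\<And>z. z \<notin> sphere_compl E \<Longrightarrow> g z = 0"
      by (auto simp: sphere_unit_ball_iff)
    show "g = f0"
    proof
      fix q show "g q = f0 q"
        using extremal_unique[OF E g f0 f0'] g0 by (cases "q \<in> sphere_compl E") (auto simp: f0_def)
    qed
  qed
  then show ?thesis using p by (simp add: f0_def)
qed

section \<open>Cauchy transforms\<close>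

lemma finite_measure_on_compact_positive_variation:
  assumes "signed_borel_measure \<nu>" "compact E"
    and "\<And>A. A \<in> sets borel \<Longrightarrow> A \<inter> E = {} \<Longrightarrow> \<nu> A = 0"
  shows "finite_measure_on_compact (positive_variation \<nu>) E"
proof -
  interpret signed_borel_measure \<nu> by fact
  interpret finite_measure "positive_variation \<nu>"
    by (rule finite_measure_positive_variation)
  show ?thesis
    using AE_positive_variation[OF assms(1) borel_compact[OF assms(2)] assms(3)] assms(2)
    by unfold_locales auto
qed

lemma signed_Cauchy_integral:
  assumes "signed_borel_measure \<nu>" "compact E"
    and null: "\<And>A. A \<in> sets borel \<Longrightarrow> A \<inter> E = {} \<Longrightarrow> \<nu> A = 0"
  shows "(\<lambda>z. signed_integral \<nu> (\<lambda>\<xi>. 1 / (\<xi> - z))) holomorphic_on - E"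
    and "((\<lambda>z. z * signed_integral \<nu> (\<lambda>\<xi>. 1 / (\<xi> - z))) \<longlongrightarrow> - of_real (\<nu> E)) at_infinity"
proof -
  interpret p: finite_measure_on_compact "positive_variation \<nu>" E
    using assms by (rule finite_measure_on_compact_positive_variation)
  interpret n: finite_measure_on_compact "positive_variation (\<lambda>A. - \<nu> A)" E
    using assms by (intro finite_measure_on_compact_positive_variation signed_borel_measure_uminus) auto
  interpret signed_borel_measure \<nu> by fact
  show "(\<lambda>z. signed_integral \<nu> (\<lambda>\<xi>. 1 / (\<xi> - z))) holomorphic_on - E"
    unfolding signed_integral_def
    by (intro holomorphic_intros p.Cauchy_integral_holomorphic n.Cauchy_integral_holomorphic)
  \<comment> \<open>The limits at infinity yield total masses on the plane; the support condition
    turns their difference into \<open>\<nu> E\<close>.\<close>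
  have "\<nu> UNIV = \<nu> E + \<nu> (- E)"
    using additive[of E "- E"] borel_compact[OF assms(2)] by simp
  also have "\<nu> (- E) = 0"
    using borel_compact[OF assms(2)] by (intro null) auto
  finally have "\<nu> E = measure (positive_variation \<nu>) UNIV - measure (positive_variation (\<lambda>A. - \<nu> A)) UNIV"
    using Jordan_decomposition[OF assms(1), of UNIV] by simp
  then show "((\<lambda>z. z * signed_integral \<nu> (\<lambda>\<xi>. 1 / (\<xi> - z))) \<longlongrightarrow> - of_real (\<nu> E)) at_infinity"
    using tendsto_diff[OF p.Cauchy_integral_at_infinity n.Cauchy_integral_at_infinity]
    by (simp add: signed_integral_def right_diff_distrib)
qed

lemma signed_borel_measure_Re_Im:
  assumes "complex_borel_measure \<mu>"
  shows "signed_borel_measure (\<lambda>A. Re (\<mu> A))" "signed_borel_measure (\<lambda>A. Im (\<mu> A))"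
proof -
  have "(\<lambda>n. \<mu> (A n)) sums \<mu> (\<Union>n. A n)"
    if "range A \<subseteq> sets borel" "disjoint_family A" for A :: "nat \<Rightarrow> complex set"
    using assms that unfolding complex_borel_measure_def by simp
  then show "signed_borel_measure (\<lambda>A. Re (\<mu> A))" "signed_borel_measure (\<lambda>A. Im (\<mu> A))"
    by (auto intro!: signed_borel_measure.intro sums_Re sums_Im)
qed

lemma cauchy_transform_sphere:
  assumes "complex_borel_measure \<mu>" "supported_on \<mu> E" "compact E"
  shows "has_deriv_infty (cauchy_transform \<mu>) (- \<mu> E)"
    and "sphere_holomorphic_on (cauchy_transform \<mu>) (sphere_compl E)"
proof -
  have null: "Re (\<mu> A) = 0" "Im (\<mu> A) = 0" if "A \<in> sets borel" "A \<inter> E = {}" for A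
    using assms(2) that by (auto simp: supported_on_def)
  note re = signed_Cauchy_integral[OF signed_borel_measure_Re_Im(1)[OF assms(1)] assms(3) null(1)]
    and im = signed_Cauchy_integral[OF signed_borel_measure_Re_Im(2)[OF assms(1)] assms(3) null(2)]
  have "((\<lambda>z. z * signed_integral (\<lambda>A. Re (\<mu> A)) (\<lambda>\<xi>. 1 / (\<xi> - z))
        + \<i> * (z * signed_integral (\<lambda>A. Im (\<mu> A)) (\<lambda>\<xi>. 1 / (\<xi> - z))))
      \<longlongrightarrow> - of_real (Re (\<mu> E)) + \<i> * - of_real (Im (\<mu> E))) at_infinity"
    by (intro tendsto_intros re(2) im(2))
  moreover have "- of_real (Re (\<mu> E)) + \<i> * - of_real (Im (\<mu> E)) = - \<mu> E"
    by (simp add: complex_eq_iff)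
  ultimately show deriv: "has_deriv_infty (cauchy_transform \<mu>) (- \<mu> E)"
    by (simp add: cauchy_transform_def complex_measure_integral_def distrib_left mult.left_commute)
  have "(\<lambda>z. cauchy_transform \<mu> (Some z)) holomorphic_on - E"
    unfolding cauchy_transform_def complex_measure_integral_def option.case
    by (intro holomorphic_intros re(1) im(1))
  then show "sphere_holomorphic_on (cauchy_transform \<mu>) (sphere_compl E)"
    using deriv by (rule sphere_holomorphic_onI[OF assms(3)])
qed

text \<open>Negation exchanges the two variations in \<open>signed_integral\<close>.\<close>

lemma cauchy_transform_uminus: "cauchy_transform (\<lambda>A. - \<mu> A) p = - cauchy_transform \<mu> p"
  by (cases p) (simp_all add: cauchy_transform_def complex_measure_integral_def signed_integral_def
      right_diff_distrib)

lemma complex_borel_measure_uminus: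
  "complex_borel_measure \<mu> \<Longrightarrow> complex_borel_measure (\<lambda>A. - \<mu> A)"
  by (simp add: complex_borel_measure_def sums_minus)

theorem corollary2p7:
  fixes E :: "complex set"
  assumes "compact E" and "connected E"
    and "connectedin riemann_sphere (sphere_compl E)"
    and "analytic_capacity E > 0"
    and "analytic_capacity E = cauchy_capacity E"
    and "\<not> (\<exists>\<mu>. complex_borel_measure \<mu> \<and> supported_on \<mu> E \<and>
              (\<forall>z\<in>sphere_compl E. ahlfors_function E z = cauchy_transform \<mu> z))"
  shows "\<not> (\<exists>\<mu>. complex_borel_measure \<mu> \<and> supported_on \<mu> E \<and>
              (\<forall>z\<in>sphere_compl E. cmod (cauchy_transform \<mu> z) \<le> 1) \<and>
              \<mu> E = complex_of_real (cauchy_capacity E))"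
proof
  assume "\<exists>\<mu>. complex_borel_measure \<mu> \<and> supported_on \<mu> E \<and>
              (\<forall>z\<in>sphere_compl E. cmod (cauchy_transform \<mu> z) \<le> 1) \<and>
              \<mu> E = complex_of_real (cauchy_capacity E)"
  then obtain \<mu> where \<mu>: "complex_borel_measure \<mu>" "supported_on \<mu> E"
    and bound: "\<And>z. z \<in> sphere_compl E \<Longrightarrow> cmod (cauchy_transform \<mu> z) \<le> 1"
    and "\<mu> E = complex_of_real (cauchy_capacity E)"
    by blast
  then have \<mu>_E: "\<mu> E = of_real (analytic_capacity E)"
    using assms(5) by simp
  define \<mu>' where "\<mu>' A = - \<mu> A" for A
  have \<mu>': "complex_borel_measure \<mu>'" "supported_on \<mu>' E"
    using \<mu> complex_borel_measure_uminus[of \<mu>] by (auto simp: \<mu>'_def [abs_def] supported_on_def)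
  have "cauchy_transform \<mu>' \<in> sphere_unit_ball E"
    using cauchy_transform_sphere(2)[OF \<mu>' assms(1)] bound
    by (simp add: sphere_unit_ball_def \<mu>'_def [abs_def] cauchy_transform_uminus)
  moreover have "deriv_infty (cauchy_transform \<mu>') = of_real (analytic_capacity E)"
    unfolding deriv_infty_eq[OF cauchy_transform_sphere(1)[OF \<mu>' assms(1)]]
    by (simp add: \<mu>'_def \<mu>_E)
  ultimately have "ahlfors_function E z = cauchy_transform \<mu>' z" if "z \<in> sphere_compl E" for z
    using ahlfors_function_eq[OF assms(1,3,4) _ _ that] by blast
  with \<mu>' assms(6) show False by blast
qed

end
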